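(* Let $m\ge3$ and $1\le\ell\le\lfloor\frac{m-1}{2}\rfloor$ be integers and $\kappa\in\mathbb{R}$. The forms $\langle\cdot,\cdot\rangle$ and $\langle\cdot,\cdot\rangle_G$ are positive definite on the space of harmonic polynomials in $\mathcal{P}_{m,\ell}$ if and only if $-\frac{\ell}{m}<\kappa<\frac{\ell}{m}$. Moreover, if $-\frac{\ell}{m}<\kappa<\frac{\ell}{m}$ then both forms are positive definite on $\mathcal{P}_{m,\ell}$.
   Context: Set $\omega=e^{2\pi\mathrm{i}/m}$. $\mathcal{P}_{m,\ell}$ is the complex vector space of polynomials $f(z,\overline z,t,\overline t)=f_1(z,\overline z)t+f_2(z,\overline z)\overline t$ with $f_1,f_2\in\mathbb{C}[z,\overline z]$. Dunkl operators on $\mathcal{P}_{m,\ell}$: $$\mathcal{D}f=\frac{\partial f}{\partial z}+\kappa\sum_{j=0}^{m-1}\frac{f(z,\overline z,\omega^{\ell j}\overline t,\omega^{-\ell j}t)-f(\overline z\omega^j,z\omega^{-j},\omega^{\ell j}\overline t,\omega^{-\ell j}t)}{z-\overline z\omega^j},$$ $$\overline{\mathcal{D}}f=\frac{\partial f}{\partial\overline z}-\kappa\sum_{j=0}^{m-1}\frac{f(z,\overline z,\omega^{\ell j}\overline t,\omega^{-\ell j}t)-f(\overline z\omega^j,z\omega^{-j},\omega^{\ell j}\overline t,\omega^{-\ell j}t)}{z-\overline z\omega^j}\,\omega^j.$$ They commute. Put $\Delta_\kappa=4\mathcal{D}\overline{\mathcal{D}}$; $f$ is harmonic if $\mathcal{D}\overline{\mathcal{D}}f=0$.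 For $p=\sum a_{jk}z^j\overline z^k$ let $p^*(2\overline{\mathcal D},2\mathcal D)=\sum\overline{a_{jk}}\,2^{j+k}\mathcal{D}^j\overline{\mathcal{D}}^k$. The form $\langle\cdot,\cdot\rangle$ on $\mathcal{P}_{m,\ell}$ is conjugate-linear in the first and linear in the second variable, with $\langle t,t\rangle=\langle\overline t,\overline t\rangle=2$, $\langle t,\overline t\rangle=\langle\overline t,t\rangle=0$, and $$\langle p_1t+p_2\overline t,q\rangle=\langle t,p_1^*(2\overline{\mathcal D},2\mathcal D)q\rangle|_{z=0}+\langle\overline t,p_2^*(2\overline{\mathcal D},2\mathcal D)q\rangle|_{z=0}.$$ The Gaussian form is $\langle f,g\rangle_G=\langle e^{\Delta_\kappa/2}f,e^{\Delta_\kappa/2}g\rangle$. *)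

theory Defs
  imports
    "HOL-Analysis.Analysis"
    "HOL-Computational_Algebra.Computational_Algebra"
    "HOL-Library.Groups_Big_Fun"
begin

text \<open>
  The ring \<open>\<complex>[z, zb]\<close> (\<open>zb\<close> stands for the conjugate variable) is rendered as
  \<open>complex poly poly\<close>: the inner indeterminate is \<open>z\<close>, the outer one is \<open>zb\<close>, so the
  coefficient of \<open>z^j * zb^k\<close> in \<open>p\<close> is \<open>coeff (coeff p k) j\<close>.
  An element \<open>f1 * t + f2 * tb\<close> of the space under study is the pair \<open>(f1, f2)\<close>.
\<close>

type_synonym bipoly = "complex poly poly"
type_synonym vpoly = "bipoly \<times> bipoly"

definition const2 :: "complex \<Rightarrow> bipoly" where
  "const2 c = [:[:c:]:]"

definition var_z :: bipoly where
  "var_z = [:[:0, 1:]:]"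

definition var_zb :: bipoly where
  "var_zb = [:0, 1:]"

definition d_z :: "bipoly \<Rightarrow> bipoly" where
  "d_z p = map_poly pderiv p"

definition d_zb :: "bipoly \<Rightarrow> bipoly" where
  "d_zb p = pderiv p"

text \<open>\<open>subst2 p u v\<close> is \<open>p(u, v)\<close>.\<close>

definition subst2 :: "bipoly \<Rightarrow> bipoly \<Rightarrow> bipoly \<Rightarrow> bipoly" where
  "subst2 p u v = poly (map_poly (\<lambda>q. poly (map_poly const2 q) u) p) v"

definition eval0 :: "bipoly \<Rightarrow> complex" where
  "eval0 p = poly (poly p 0) 0"

definition vscale :: "complex \<Rightarrow> vpoly \<Rightarrow> vpoly" where
  "vscale c f = (const2 c * fst f, const2 c * snd f)"

definition omega :: "nat \<Rightarrow> complex" where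
  "omega m = exp (2 * of_real pi * \<i> / of_nat m)"

text \<open>
  \<open>f(z, zb, \<omega>^(l j) tb, \<omega>^(- l j) t) = (\<omega>^(- l j) f2) t + (\<omega>^(l j) f1) tb\<close>.
\<close>

definition twist :: "nat \<Rightarrow> nat \<Rightarrow> nat \<Rightarrow> vpoly \<Rightarrow> vpoly" where
  "twist m l j f =
     (const2 (omega m powi (- int (l * j))) * snd f,
      const2 (omega m powi (int (l * j))) * fst f)"

definition reflect_arg :: "nat \<Rightarrow> nat \<Rightarrow> bipoly \<Rightarrow> bipoly" where
  "reflect_arg m j p =
     subst2 p (const2 (omega m ^ j) * var_zb) (const2 (omega m powi (- int j)) * var_z)"

text \<open>The \<open>div\<close> below is an exact division, see \<open>reflect_diff_dvd\<close>.\<close>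

definition div_diff :: "nat \<Rightarrow> nat \<Rightarrow> bipoly \<Rightarrow> bipoly" where
  "div_diff m j p = (p - reflect_arg m j p) div (var_z - const2 (omega m ^ j) * var_zb)"

definition vdiv_diff :: "nat \<Rightarrow> nat \<Rightarrow> nat \<Rightarrow> vpoly \<Rightarrow> vpoly" where
  "vdiv_diff m l j f = map_prod (div_diff m j) (div_diff m j) (twist m l j f)"

definition dunkl :: "nat \<Rightarrow> nat \<Rightarrow> real \<Rightarrow> vpoly \<Rightarrow> vpoly" where
  "dunkl m l \<kappa> f =
     map_prod d_z d_z f + vscale (of_real \<kappa>) (\<Sum>j<m. vdiv_diff m l j f)"

definition dunkl_bar :: "nat \<Rightarrow> nat \<Rightarrow> real \<Rightarrow> vpoly \<Rightarrow> vpoly" where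
  "dunkl_bar m l \<kappa> f =
     map_prod d_zb d_zb f
       - vscale (of_real \<kappa>) (\<Sum>j<m. vscale (omega m ^ j) (vdiv_diff m l j f))"

definition dunkl_laplace :: "nat \<Rightarrow> nat \<Rightarrow> real \<Rightarrow> vpoly \<Rightarrow> vpoly" where
  "dunkl_laplace m l \<kappa> f = vscale 4 (dunkl m l \<kappa> (dunkl_bar m l \<kappa> f))"

definition harmonics :: "nat \<Rightarrow> nat \<Rightarrow> real \<Rightarrow> vpoly set" where
  "harmonics m l \<kappa> = {f. dunkl m l \<kappa> (dunkl_bar m l \<kappa> f) = 0}"

text \<open>\<open>star_op m l \<kappa> p q\<close> is \<open>p^*(2 Db, 2 D) q\<close>, with \<open>D\<close>, \<open>Db\<close> the two Dunkl operators.\<close>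

definition star_op :: "nat \<Rightarrow> nat \<Rightarrow> real \<Rightarrow> bipoly \<Rightarrow> vpoly \<Rightarrow> vpoly" where
  "star_op m l \<kappa> p q =
     (\<Sum>k\<le>degree p. \<Sum>j\<le>degree (coeff p k).
        vscale (cnj (coeff (coeff p k) j) * 2 ^ (j + k))
          ((dunkl m l \<kappa> ^^ j) ((dunkl_bar m l \<kappa> ^^ k) q)))"

text \<open>The form on the span of \<open>t = (1, 0)\<close> and \<open>tb = (0, 1)\<close>.\<close>

definition tform :: "complex \<times> complex \<Rightarrow> complex \<times> complex \<Rightarrow> complex" where
  "tform a b = 2 * (cnj (fst a) * fst b + cnj (snd a) * snd b)"

definition cform :: "nat \<Rightarrow> nat \<Rightarrow> real \<Rightarrow> vpoly \<Rightarrow> vpoly \<Rightarrow> complex" where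
  "cform m l \<kappa> p q =
     tform (1, 0) (map_prod eval0 eval0 (star_op m l \<kappa> (fst p) q))
     + tform (0, 1) (map_prod eval0 eval0 (star_op m l \<kappa> (snd p) q))"

text \<open>
  The Dunkl Laplacian lowers the total degree in \<open>z, zb\<close> by two, so only finitely many terms
  of the exponential series are nonzero.
\<close>

definition exp_half_laplace :: "nat \<Rightarrow> nat \<Rightarrow> real \<Rightarrow> vpoly \<Rightarrow> vpoly" where
  "exp_half_laplace m l \<kappa> f =
     Sum_any (\<lambda>n. vscale (1 / (2 ^ n * fact n)) ((dunkl_laplace m l \<kappa> ^^ n) f))"

definition gauss_form :: "nat \<Rightarrow> nat \<Rightarrow> real \<Rightarrow> vpoly \<Rightarrow> vpoly \<Rightarrow> complex" where
  "gauss_form m l \<kappa> f g =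
     cform m l \<kappa> (exp_half_laplace m l \<kappa> f) (exp_half_laplace m l \<kappa> g)"

text \<open>
  For a sesquilinear form on a complex space, realness of all \<open>B f f\<close> already
  gives the Hermitian symmetry.
\<close>

definition pos_def_on :: "vpoly set \<Rightarrow> (vpoly \<Rightarrow> vpoly \<Rightarrow> complex) \<Rightarrow> bool" where
  "pos_def_on S B \<longleftrightarrow> (\<forall>f\<in>S. f \<noteq> 0 \<longrightarrow> B f f \<in> \<real> \<and> Re (B f f) > 0)"

lemma reflect_diff_dvd:
  "(var_z - const2 (omega m ^ j) * var_zb) dvd (p - reflect_arg m j p)"
proof -
  define w where "w = omega m ^ j"
  have w0: "w \<noteq> 0" by (simp add: w_def omega_def)
  have wi: "omega m powi (- int j) = inverse w"
    by (simp add: w_def power_int_minus)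
  define c where "c = [:0, inverse w:]"
  have inner: "poly (poly (map_poly const2 q) (const2 w * var_zb)) c = q" for q
  proof (induction q)
    case 0
    then show ?case by simp
  next
    case (pCons a q)
    have "poly (const2 w * var_zb) c = [:0, 1:]"
      using w0 by (simp add: const2_def var_zb_def c_def)
    moreover have "map_poly const2 (pCons a q) = pCons (const2 a) (map_poly const2 q)"
      using pCons.hyps by (simp add: map_poly_pCons const2_def)
    moreover have "poly (const2 a) c = [:a:]"
      by (simp add: const2_def)
    moreover have "[:a:] + [:0, 1:] * q = pCons a q"
      by simp
    ultimately show ?case
      using pCons.IH by (simp del: mult_pCons_left add_pCons)
  qed
  have sub: "poly (subst2 p (const2 w * var_zb) (const2 (inverse w) * var_z)) c = poly p c"
  proof (induction p)
    case 0
    then show ?case by (simp add: subst2_def)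
  next
    case (pCons q p)
    have "poly (const2 (inverse w) * var_z) c = c"
      by (simp add: const2_def var_z_def c_def)
    then show ?case
      using pCons by (simp add: subst2_def map_poly_pCons inner)
  qed
  have "poly (p - reflect_arg m j p) c = 0"
    by (simp add: reflect_arg_def wi sub flip: w_def)
  then have "[:- c, 1:] dvd (p - reflect_arg m j p)"
    by (simp only: poly_eq_0_iff_dvd)
  moreover have "[:- c, 1:] = const2 (- inverse w) * (var_z - const2 w * var_zb)"
    using w0 by (simp add: c_def const2_def var_z_def var_zb_def)
  ultimately show ?thesis
    unfolding w_def by (metis dvd_mult_right)
qed

end

(*
  Multiplication by z is adjoint to 2 D and multiplication by zb to 2 Db. With S the sum of all
  reflections (acting on z, zb and on t, tb simultaneously) and E the Euler operator,
  z D + zb Db = E - kappa S. Hence, if f is homogeneous of degree n and S f = a f, then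
    (n - kappa a) <f, f> = 2 <D f, D f> + 2 <Db f, Db f>.
  The eigenvalues of S are 0, m and -m, and only 0 occurs in degrees below l; so for
  |kappa| < l/m the factor n - kappa a is positive for n >= 1, and induction on n gives
  positivity on the whole space. Conversely, zb^l t + s z^l tb with s = 1, -1 is harmonic with
  square norm a positive multiple of l - s kappa m. Finally exp(Delta/2) is injective, and it is
  the identity on harmonic polynomials.
*)

theory Submission
  imports Defs
begin

text \<open>Divided differences are hard to compute with, so they are used only to find the
  commutators of D and Db with z and zb. Those commutators, and the vanishing of D and Db on t and
  tb, determine both operators. Every later operator identity is then checked on t and tb and
  carried through multiplication by z and zb. The sum S of all reflections is not closed under this
  scheme: the j-th reflection turns z into omega^j zb, so moving z across S yields a sum weighted by
  omega^j. Hence the family S_k with weights omega^(k j), k an integer, in which each factor z or zb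
  shifts k by one. This family also explains the spectrum and the role of l. The relation S_k S_(-k)
  S_k = m^2 S_k gives S^3 = m^2 S at k = 0. On t and tb, S_k is a sum of powers of omega with
  exponent k + l or k - l, and one degree changes the exponent by at most one. So nothing survives
  below degree l, and in degree l the exponent 0 occurs first for zb^l t and z^l tb. Realness of the
  squared norm is carried along in the degree induction.\<close>

section \<open>Linear operators on vector polynomials\<close>

lemma const2_simps [simp]:
  "const2 0 = 0" "const2 1 = 1"
  by (simp_all add: const2_def one_pCons)

lemma const2_add: "const2 (a + b) = const2 a + const2 b"
  by (simp add: const2_def)

lemma const2_mult: "const2 (a * b) = const2 a * const2 b"
  by (simp add: const2_def)

lemma coeff_const2_mult [simp]: "coeff (coeff (const2 c * p) k) j = c * coeff (coeff p k) j"
  by (simp add: const2_def)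

lemma var_zb_mult: "var_zb * p = pCons 0 p"
  by (simp add: var_zb_def)

lemma var_z_mult: "var_z * p = smult [:0, 1:] p"
  by (simp add: var_z_def)

definition vmul :: "bipoly \<Rightarrow> vpoly \<Rightarrow> vpoly" where
  "vmul p f = (p * fst f, p * snd f)"

abbreviation Z :: "vpoly \<Rightarrow> vpoly" where "Z \<equiv> vmul var_z"
abbreviation Zb :: "vpoly \<Rightarrow> vpoly" where "Zb \<equiv> vmul var_zb"

lemma vscale_eq_vmul: "vscale c = vmul (const2 c)"
  by (simp add: fun_eq_iff vscale_def vmul_def)

interpretation vs: vector_space vscale
  by unfold_locales
     (simp_all add: vscale_def const2_add const2_mult algebra_simps prod_eq_iff)

definition linop :: "(vpoly \<Rightarrow> vpoly) \<Rightarrow> bool" where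
  "linop T \<longleftrightarrow> (\<forall>f g. T (f + g) = T f + T g) \<and> (\<forall>c f. T (vscale c f) = vscale c (T f))"

lemma linopI:
  assumes "\<And>f g. T (f + g) = T f + T g" and "\<And>c f. T (vscale c f) = vscale c (T f)"
  shows "linop T"
  unfolding linop_def using assms by blast

lemma
  assumes "linop T"
  shows linop_add: "T (f + g) = T f + T g"
    and linop_scale: "T (vscale c f) = vscale c (T f)"
  using assms unfolding linop_def by blast+

lemma linop_zero:
  assumes "linop T" shows "T 0 = 0"
  using linop_scale[OF assms, of 0 0] by simp

lemma linop_uminus:
  assumes "linop T" shows "T (- f) = - T f"
  using linop_scale[OF assms, of "-1" f] by simp

lemma linop_diff:
  assumes "linop T" shows "T (f - g) = T f - T g"
  using linop_add[OF assms, of f "- g"] linop_uminus[OF assms, of g] by simp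

lemma linop_sum:
  assumes "linop T" shows "T (sum F A) = (\<Sum>x\<in>A. T (F x))"
  by (induction A rule: infinite_finite_induct)
     (simp_all add: linop_add[OF assms] linop_zero[OF assms])

lemmas linop_rules = linop_add linop_scale linop_zero linop_uminus linop_diff linop_sum

lemma linop_comp: "linop S \<Longrightarrow> linop T \<Longrightarrow> linop (\<lambda>f. S (T f))"
  by (rule linopI) (simp_all only: linop_add linop_scale)

lemma linop_plus: "linop S \<Longrightarrow> linop T \<Longrightarrow> linop (\<lambda>f. S f + T f)"
  by (rule linopI) (simp_all only: linop_add linop_scale vs.scale_right_distrib add_ac)

lemma linop_minus: "linop S \<Longrightarrow> linop T \<Longrightarrow> linop (\<lambda>f. S f - T f)"
  by (rule linopI) (simp_all only: linop_add linop_scale vs.scale_right_diff_distrib add_diff_add)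

lemma linop_sum_ops: "(\<And>x. linop (T x)) \<Longrightarrow> linop (\<lambda>f. \<Sum>x\<in>A. T x f)"
  by (rule linopI) (simp_all only: linop_add linop_scale vs.scale_sum_right sum.distrib)

lemma linop_vmul: "linop (vmul p)"
  by (simp add: linop_def vmul_def vscale_def algebra_simps)

lemma linop_vscale: "linop (vscale c)"
  unfolding vscale_eq_vmul by (rule linop_vmul)

lemma linop_funpow: "linop T \<Longrightarrow> linop (T ^^ n)"
proof (induction n)
  case 0
  then show ?case by (simp add: linop_def)
next
  case (Suc n)
  from linop_comp[OF Suc.prems Suc.IH[OF Suc.prems]] show ?case by (simp add: o_def)
qed

lemma linop_map_prod:
  assumes "\<And>p q. T (p + q) = T p + T q" and "\<And>c p. T (const2 c * p) = const2 c * T p"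
  shows "linop (map_prod T T)"
  using assms by (simp add: linop_def vscale_def prod_eq_iff)

lemma bipoly_induct:
  assumes one: "P 1"
    and add: "\<And>p q. P p \<Longrightarrow> P q \<Longrightarrow> P (p + q)"
    and scale: "\<And>c p. P p \<Longrightarrow> P (const2 c * p)"
    and z: "\<And>p. P p \<Longrightarrow> P (var_z * p)"
    and zb: "\<And>p. P p \<Longrightarrow> P (var_zb * p)"
  shows "P p"
proof -
  have inner: "P [:q:]" for q
  proof (induction q)
    case 0
    show ?case using scale[OF one, of 0] by simp
  next
    case (pCons a q)
    have "[:pCons a q:] = const2 a * 1 + var_z * [:q:]"
      by (simp add: const2_def var_z_def)
    then show ?case using add[OF scale[OF one] z[OF pCons.IH]] by simp
  qed
  show ?thesis
  proof (induction p)
    case 0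
    show ?case using scale[OF one, of 0] by simp
  next
    case (pCons a p)
    have "pCons a p = [:a:] + var_zb * p" by (simp add: var_zb_def)
    then show ?case using add[OF inner zb[OF pCons.IH]] by simp
  qed
qed

text \<open>The pairs form a free module over the polynomial ring with basis t, tb. A linear
  identity thus needs checking on t and tb, plus two steps that commute it past \<open>Z\<close> and
  \<open>Zb\<close>.\<close>

lemma vpoly_induct [case_names t tb add scale Z Zb]:
  assumes t: "P (1, 0)" and tb: "P (0, 1)"
    and add: "\<And>f g. P f \<Longrightarrow> P g \<Longrightarrow> P (f + g)"
    and scale: "\<And>c f. P f \<Longrightarrow> P (vscale c f)"
    and z: "\<And>f. P f \<Longrightarrow> P (Z f)"
    and zb: "\<And>f. P f \<Longrightarrow> P (Zb f)"
  shows "P f"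
proof -
  have "P (p, 0)" for p
  proof (induction p rule: bipoly_induct)
    case (2 p q) then show ?case using add[of "(p, 0)" "(q, 0)"] by simp
  next
    case (3 c p) then show ?case using scale[of "(p, 0)" c] by (simp add: vscale_def)
  next
    case (4 p) then show ?case using z[of "(p, 0)"] by (simp add: vmul_def)
  next
    case (5 p) then show ?case using zb[of "(p, 0)"] by (simp add: vmul_def)
  qed (rule t)
  moreover have "P (0, p)" for p
  proof (induction p rule: bipoly_induct)
    case (2 p q) then show ?case using add[of "(0, p)" "(0, q)"] by simp
  next
    case (3 c p) then show ?case using scale[of "(0, p)" c] by (simp add: vscale_def)
  next
    case (4 p) then show ?case using z[of "(0, p)"] by (simp add: vmul_def)
  next
    case (5 p) then show ?case using zb[of "(0, p)"] by (simp add: vmul_def)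
  qed (rule tb)
  ultimately show ?thesis using add[of "(fst f, 0)" "(0, snd f)"] by simp
qed

section \<open>Leibniz rules for the partial derivatives and substitution rules for the
  reflections\<close>

lemma d_z_add: "d_z (p + q) = d_z p + d_z q"
  by (intro poly_eqI) (simp add: d_z_def coeff_map_poly pderiv_add)

lemma d_z_scale: "d_z (const2 c * p) = const2 c * d_z p"
  by (intro poly_eqI) (simp add: d_z_def coeff_map_poly const2_def pderiv_smult)

lemma d_z_var_z: "d_z (var_z * p) = p + var_z * d_z p"
  unfolding d_z_def var_z_mult
  by (intro poly_eqI) (simp add: coeff_map_poly pderiv_pCons)

lemma d_z_var_zb: "d_z (var_zb * p) = var_zb * d_z p"
  unfolding d_z_def var_zb_mult by (simp add: map_poly_pCons)

lemma d_zb_add: "d_zb (p + q) = d_zb p + d_zb q"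
  by (simp add: d_zb_def pderiv_add)

lemma d_zb_scale: "d_zb (const2 c * p) = const2 c * d_zb p"
  by (simp add: d_zb_def const2_def pderiv_smult)

lemma d_zb_var_z: "d_zb (var_z * p) = var_z * d_zb p"
  by (simp add: d_zb_def var_z_mult pderiv_smult)

lemma d_zb_var_zb: "d_zb (var_zb * p) = p + var_zb * d_zb p"
  by (simp add: d_zb_def var_zb_mult pderiv_pCons)

lemma d_const [simp]: "d_z 0 = 0" "d_z 1 = 0" "d_zb 0 = 0" "d_zb 1 = 0"
  by (simp_all add: d_z_def d_zb_def map_poly_1 one_pCons map_poly_pCons pderiv_pCons)

lemma map_poly_add_hom:
  assumes "\<And>a b. h (a + b) = h a + h b" and "h 0 = 0"
  shows "map_poly h (p + q) = map_poly h p + map_poly h q"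
  by (intro poly_eqI) (simp add: coeff_map_poly assms)

lemma map_poly_smult_hom:
  assumes "\<And>a. h (c * a) = d * h a" and "h 0 = 0"
  shows "map_poly h (smult c p) = smult d (map_poly h p)"
  by (intro poly_eqI) (simp add: coeff_map_poly assms)

lemma subst_inner:
  fixes u :: bipoly
  defines "h \<equiv> \<lambda>q. poly (map_poly const2 q) u"
  shows "h 0 = 0" and "h (p + q) = h p + h q" and "h (smult c q) = const2 c * h q"
    and "h (pCons 0 q) = u * h q" and "h 1 = 1"
proof -
  show "h (smult c q) = const2 c * h q"
    by (simp add: h_def map_poly_smult_hom[where d = "const2 c"] const2_mult)
qed (simp_all add: h_def map_poly_add_hom const2_add map_poly_pCons one_pCons)

lemma reflect_arg_add: "reflect_arg m j (p + q) = reflect_arg m j p + reflect_arg m j q"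
  unfolding reflect_arg_def subst2_def
  by (simp add: map_poly_add_hom subst_inner)

lemma reflect_arg_scale: "reflect_arg m j (const2 c * p) = const2 c * reflect_arg m j p"
proof -
  have "const2 c * p = smult [:c:] p" by (simp add: const2_def)
  show ?thesis
    unfolding reflect_arg_def subst2_def \<open>const2 c * p = _\<close>
    by (subst map_poly_smult_hom[where d = "const2 c"]) (simp_all add: subst_inner)
qed

lemma reflect_arg_z:
  "reflect_arg m j (var_z * p) = const2 (omega m ^ j) * var_zb * reflect_arg m j p"
  unfolding reflect_arg_def subst2_def var_z_mult
  by (subst map_poly_smult_hom[where d = "const2 (omega m ^ j) * var_zb"]) (simp_all add: subst_inner)

lemma reflect_arg_zb:
  "reflect_arg m j (var_zb * p) = const2 (inverse (omega m ^ j)) * var_z * reflect_arg m j p"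
  unfolding reflect_arg_def subst2_def var_zb_mult
  by (simp add: map_poly_pCons subst_inner power_int_minus)

lemma reflect_arg_const [simp]: "reflect_arg m j 0 = 0" "reflect_arg m j 1 = 1"
  by (simp_all add: reflect_arg_def subst2_def one_pCons map_poly_pCons subst_inner
      flip: one_pCons)

section \<open>Divided differences and reflections\<close>

definition mirror_line :: "nat \<Rightarrow> nat \<Rightarrow> bipoly" where
  "mirror_line m j = var_z - const2 (omega m ^ j) * var_zb"

lemma omega_nonzero [simp]: "omega m \<noteq> 0"
  by (simp add: omega_def)

lemma const2_inverse: "c \<noteq> 0 \<Longrightarrow> const2 c * const2 (inverse c) = 1"
  by (simp flip: const2_mult)

lemma mirror_line_nonzero [simp]: "mirror_line m j \<noteq> 0"
proof
  assume "mirror_line m j = 0"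
  then have "coeff (coeff (mirror_line m j) 0) 1 = 0" by simp
  then show False by (simp add: mirror_line_def var_z_def var_zb_def const2_def)
qed

lemma mirror_line_div_diff: "mirror_line m j * div_diff m j p = p - reflect_arg m j p"
  unfolding div_diff_def mirror_line_def by (rule dvd_mult_div_cancel[OF reflect_diff_dvd])

text \<open>Identities about quotients are proved after multiplying by the nonzero linear form,
  which turns the exact division back into a difference.\<close>

lemma vmul_mirror_line_cancel:
  "vmul (mirror_line m j) f = vmul (mirror_line m j) g \<Longrightarrow> f = g"
  by (simp add: vmul_def prod_eq_iff)

lemma div_diff_add: "div_diff m j (p + q) = div_diff m j p + div_diff m j q"
  by (rule mult_left_cancel[OF mirror_line_nonzero[of m j], THEN iffD1])
     (simp add: mirror_line_div_diff reflect_arg_add distrib_left)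

lemma div_diff_scale: "div_diff m j (const2 c * p) = const2 c * div_diff m j p"
  by (rule mult_left_cancel[OF mirror_line_nonzero[of m j], THEN iffD1])
     (simp add: mirror_line_div_diff reflect_arg_scale right_diff_distrib mult.left_commute)

lemma div_diff_const [simp]: "div_diff m j 0 = 0" "div_diff m j (const2 c) = 0"
  using div_diff_scale[of m j c 1] by (simp_all add: div_diff_def)

lemma vmul_vmul: "vmul p (vmul q f) = vmul (p * q) f"
  by (simp add: vmul_def mult.assoc)

lemma vmul_commute: "vmul p (vmul q f) = vmul q (vmul p f)"
  by (simp add: vmul_def mult.left_commute)

lemma vmul_diff_left: "vmul (p - q) f = vmul p f - vmul q f"
  by (simp add: vmul_def left_diff_distrib)

lemma linop_twist: "linop (twist m l j)"
  by (rule linopI) (simp_all add: twist_def vscale_def algebra_simps)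

lemma twist_vmul: "twist m l j (vmul p f) = vmul p (twist m l j f)"
  by (simp add: twist_def vmul_def mult.left_commute)

text \<open>\<open>refl_act m l j\<close> sends \<open>f\<close> to
  \<open>f(\<omega>^j zb, \<omega>^(-j) z, \<omega>^(l j) tb, \<omega>^(- l j) t)\<close>.\<close>

definition refl_act :: "nat \<Rightarrow> nat \<Rightarrow> nat \<Rightarrow> vpoly \<Rightarrow> vpoly" where
  "refl_act m l j f = map_prod (reflect_arg m j) (reflect_arg m j) (twist m l j f)"

lemma linop_refl_act: "linop (refl_act m l j)"
  unfolding refl_act_def
  by (rule linop_comp[OF linop_map_prod linop_twist])
     (simp_all add: reflect_arg_add reflect_arg_scale)

lemma linop_vdiv_diff: "linop (vdiv_diff m l j)"
  unfolding vdiv_diff_def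
  by (rule linop_comp[OF linop_map_prod linop_twist])
     (simp_all add: div_diff_add div_diff_scale)

lemma refl_act_Z: "refl_act m l j (Z f) = vscale (omega m ^ j) (Zb (refl_act m l j f))"
  by (simp add: refl_act_def twist_vmul) (simp add: vmul_def vscale_def reflect_arg_z mult.assoc)

lemma refl_act_Zb: "refl_act m l j (Zb f) = vscale (inverse (omega m ^ j)) (Z (refl_act m l j f))"
  by (simp add: refl_act_def twist_vmul) (simp add: vmul_def vscale_def reflect_arg_zb mult.assoc)

lemma vmul_mirror_line_vdiv_diff:
  "vmul (mirror_line m j) (vdiv_diff m l j f) = twist m l j f - refl_act m l j f"
  by (simp add: vdiv_diff_def refl_act_def vmul_def mirror_line_div_diff prod_eq_iff)

text \<open>With w = omega^j, g the twisted f and r the reflected f: z g - w zb r = z (g - r) + (z -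
  w zb) r. Likewise zb g - z r / w = zb (g - r) - (z - w zb) r / w gives the rule for
  \<open>Zb\<close>.\<close>

lemma vdiv_diff_Z: "vdiv_diff m l j (Z f) = Z (vdiv_diff m l j f) + refl_act m l j f"
  by (rule vmul_mirror_line_cancel[of m j])
     (simp add: linop_add[OF linop_vmul] vmul_commute[of "mirror_line m j"]
        vmul_mirror_line_vdiv_diff linop_diff[OF linop_vmul] twist_vmul refl_act_Z,
      simp add: mirror_line_def vmul_diff_left vscale_eq_vmul vmul_vmul)

lemma vdiv_diff_Zb:
  "vdiv_diff m l j (Zb f) =
     Zb (vdiv_diff m l j f) - vscale (inverse (omega m ^ j)) (refl_act m l j f)"
proof (rule vmul_mirror_line_cancel[of m j])
  have "mirror_line m j * const2 (inverse (omega m ^ j)) =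
        const2 (inverse (omega m ^ j)) * var_z - (const2 (omega m ^ j) * const2 (inverse (omega m ^ j))) * var_zb"
    by (simp only: mirror_line_def ring_distribs mult_ac)
  also have "\<dots> = const2 (inverse (omega m ^ j)) * var_z - var_zb"
    by (subst const2_inverse) simp_all
  finally have eq: "mirror_line m j * const2 (inverse (omega m ^ j)) = \<dots>" .
  show "vmul (mirror_line m j) (vdiv_diff m l j (Zb f)) =
        vmul (mirror_line m j) (Zb (vdiv_diff m l j f) - vscale (inverse (omega m ^ j)) (refl_act m l j f))"
    by (simp add: linop_diff[OF linop_vmul] vmul_commute[of "mirror_line m j" var_zb]
        vmul_mirror_line_vdiv_diff twist_vmul refl_act_Zb)
       (simp add: vscale_eq_vmul vmul_vmul eq vmul_diff_left)
qed

lemma vdiv_diff_const: "vdiv_diff m l j (1, 0) = 0" "vdiv_diff m l j (0, 1) = 0"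
  by (simp_all add: vdiv_diff_def twist_def zero_prod_def)

section \<open>Sums of powers of roots of unity and weighted sums of reflections\<close>

lemma omega_powi: "omega m powi n = exp (of_int n * (2 * of_real pi * \<i> / of_nat m))"
  by (simp add: omega_def exp_power_int)

lemma omega_powi_eq_1_iff:
  assumes "m > 0" shows "omega m powi n = 1 \<longleftrightarrow> int m dvd n"
proof -
  have "(\<exists>k::int. 2 * pi * real_of_int n / real m = of_int (2 * k) * pi) \<longleftrightarrow> (\<exists>k. n = int m * k)"
  proof (intro ex_cong1)
    fix k :: int
    have "2 * pi * real_of_int n / real m = of_int (2 * k) * pi \<longleftrightarrow> real_of_int n = real_of_int (int m * k)"
      using assms by (simp add: field_simps)
    then show "2 * pi * real_of_int n / real m = of_int (2 * k) * pi \<longleftrightarrow> n = int m * k"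
      by (simp only: of_int_eq_iff)
  qed
  then show ?thesis
    by (simp add: omega_powi exp_eq_1 dvd_def mult_ac)
qed

definition root_sum :: "nat \<Rightarrow> int \<Rightarrow> complex" where
  "root_sum m n = (\<Sum>j<m. omega m powi (n * int j))"

lemma root_sum_eq:
  assumes "m > 0" shows "root_sum m n = (if int m dvd n then of_nat m else 0)"
proof -
  define x where "x = omega m powi n"
  have "root_sum m n = (\<Sum>j<m. x ^ j)"
    by (simp add: root_sum_def x_def power_int_mult)
  moreover have "x ^ m = 1"
    using omega_powi_eq_1_iff[OF assms, of "n * int m"] by (simp add: x_def power_int_mult)
  ultimately show ?thesis
    using omega_powi_eq_1_iff[OF assms, of n] by (simp add: x_def[symmetric] sum_gp_strict)
qed

text \<open>The weight k makes the family closed under moving z and zb across it; k = 0 is the plain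
  sum of all reflections. Negative k occurs, hence the integer type.\<close>

definition refl_sum :: "nat \<Rightarrow> nat \<Rightarrow> int \<Rightarrow> vpoly \<Rightarrow> vpoly" where
  "refl_sum m l k f = (\<Sum>j<m. vscale (omega m powi (k * int j)) (refl_act m l j f))"

lemma linop_refl_sum: "linop (refl_sum m l k)"
  unfolding refl_sum_def
  by (intro linop_sum_ops linop_comp[OF linop_vscale linop_refl_act])

lemma refl_sum_Z: "refl_sum m l k (Z f) = Zb (refl_sum m l (k + 1) f)"
  unfolding refl_sum_def refl_act_Z linop_sum[OF linop_vmul] linop_scale[OF linop_vmul] vs.scale_scale
  by (simp add: power_int_add distrib_right)

lemma refl_sum_Zb: "refl_sum m l k (Zb f) = Z (refl_sum m l (k - 1) f)"
  unfolding refl_sum_def refl_act_Zb linop_sum[OF linop_vmul] linop_scale[OF linop_vmul] vs.scale_scale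
  by (simp add: power_int_diff left_diff_distrib divide_inverse)

lemma const2_sum: "const2 (sum g A) = (\<Sum>x\<in>A. const2 (g x))"
  by (induction A rule: infinite_finite_induct) (simp_all add: const2_add)

lemma reflect_arg_const2 [simp]: "reflect_arg m j (const2 c) = const2 c"
  using reflect_arg_scale[of m j c 1] by simp

lemma refl_sum_t: "refl_sum m l k (1, 0) = vscale (root_sum m (k + int l)) (0, 1)"
  and refl_sum_tb: "refl_sum m l k (0, 1) = vscale (root_sum m (k - int l)) (1, 0)"
proof -
  show "refl_sum m l k (1, 0) = vscale (root_sum m (k + int l)) (0, 1)"
    by (simp add: refl_sum_def refl_act_def twist_def vscale_def root_sum_def prod_eq_iff
        fst_sum snd_sum const2_sum power_int_add algebra_simps flip: const2_mult)
  show "refl_sum m l k (0, 1) = vscale (root_sum m (k - int l)) (1, 0)"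
    by (simp add: refl_sum_def refl_act_def twist_def vscale_def root_sum_def prod_eq_iff
        fst_sum snd_sum const2_sum algebra_simps flip: const2_mult power_int_add)
qed

section \<open>Homogeneous components\<close>

definition euler :: "vpoly \<Rightarrow> vpoly" where
  "euler f = Z (map_prod d_z d_z f) + Zb (map_prod d_zb d_zb f)"

lemma linop_d: "linop (map_prod d_z d_z)" "linop (map_prod d_zb d_zb)"
  by (rule linop_map_prod; simp add: d_z_add d_z_scale d_zb_add d_zb_scale)+

lemma linop_euler: "linop euler"
  unfolding euler_def by (intro linop_plus linop_comp[OF linop_vmul] linop_d)

lemma linop_dunkl: "linop (dunkl m l \<kappa>)"
  unfolding dunkl_def
  by (intro linop_plus linop_d linop_comp[OF linop_vscale] linop_sum_ops linop_vdiv_diff)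

lemma linop_dunkl_bar: "linop (dunkl_bar m l \<kappa>)"
  unfolding dunkl_bar_def
  by (intro linop_minus linop_d linop_comp[OF linop_vscale] linop_sum_ops linop_vdiv_diff)

lemmas oplin =
  linop_rules[OF linop_vmul] linop_rules[OF linop_euler] linop_rules[OF linop_dunkl]
  linop_rules[OF linop_dunkl_bar] linop_rules[OF linop_refl_sum] linop_rules[OF linop_vscale]

lemma d_Z:
  "map_prod d_z d_z (Z f) = f + Z (map_prod d_z d_z f)"
  "map_prod d_z d_z (Zb f) = Zb (map_prod d_z d_z f)"
  "map_prod d_zb d_zb (Z f) = Z (map_prod d_zb d_zb f)"
  "map_prod d_zb d_zb (Zb f) = f + Zb (map_prod d_zb d_zb f)"
  by (simp_all add: vmul_def prod_eq_iff d_z_var_z d_z_var_zb d_zb_var_z d_zb_var_zb)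

lemma euler_Z: "euler (Z f) = Z (euler f) + Z f"
  and euler_Zb: "euler (Zb f) = Zb (euler f) + Zb f"
  by (simp_all add: euler_def oplin d_Z vmul_commute[of var_z var_zb] algebra_simps)

lemma euler_const: "euler (1, 0) = 0" "euler (0, 1) = 0"
  by (simp_all add: euler_def vmul_def zero_prod_def)

lemma coeff_var_z_d_z: "coeff (coeff (var_z * d_z p) k) j = of_nat j * coeff (coeff p k) j"
  by (cases j) (simp_all add: var_z_mult d_z_def coeff_map_poly coeff_pderiv)

lemma coeff_var_zb_d_zb: "coeff (coeff (var_zb * d_zb p) k) j = of_nat k * coeff (coeff p k) j"
proof (cases k)
  case (Suc i)
  have "coeff (of_nat n * q) j = of_nat n * coeff q j" for n and q :: "complex poly"
    by (simp add: of_nat_poly)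
  then show ?thesis
    using Suc by (simp only: var_zb_mult d_zb_def coeff_pCons_Suc coeff_pderiv)
qed (simp add: var_zb_mult)

lemma coeff_euler:
  "coeff (coeff (fst (euler f)) k) j = of_nat (j + k) * coeff (coeff (fst f) k) j"
  "coeff (coeff (snd (euler f)) k) j = of_nat (j + k) * coeff (coeff (snd f) k) j"
  by (simp_all add: euler_def vmul_def coeff_var_z_d_z coeff_var_zb_d_zb distrib_right)

text \<open>As eigenspaces of the Euler operator, the degrees can be tracked by commutators alone,
  without monomials.\<close>

definition homogeneous :: "nat \<Rightarrow> vpoly set" where
  "homogeneous n = {f. euler f = vscale (of_nat n) f}"

lemma homogeneous_coeff:
  assumes "f \<in> homogeneous n" and "j + k \<noteq> n"
  shows "coeff (coeff (fst f) k) j = 0" and "coeff (coeff (snd f) k) j = 0"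
proof -
  from assms(1) have eq: "euler f = vscale (of_nat n) f" by (simp add: homogeneous_def)
  from coeff_euler(1)[of f k j] assms(2) show "coeff (coeff (fst f) k) j = 0"
    by (simp add: eq vscale_def flip: of_nat_add)
  from coeff_euler(2)[of f k j] assms(2) show "coeff (coeff (snd f) k) j = 0"
    by (simp add: eq vscale_def flip: of_nat_add)
qed

lemma homogeneous_0_const:
  assumes "f \<in> homogeneous 0"
  obtains a b where "f = vscale a (1, 0) + vscale b (0, 1)"
proof -
  have const: "p = const2 (coeff (coeff p 0) 0)"
    if "\<And>j k. j + k \<noteq> 0 \<Longrightarrow> coeff (coeff p k) j = 0" for p
  proof (intro poly_eqI)
    fix k j
    show "coeff (coeff p k) j = coeff (coeff (const2 (coeff (coeff p 0) 0)) k) j"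
      using that[of j k] by (cases "j = 0"; cases "k = 0") (auto simp: const2_def coeff_pCons split: nat.splits)
  qed
  have "fst f = const2 (coeff (coeff (fst f) 0) 0)" "snd f = const2 (coeff (coeff (snd f) 0) 0)"
    using const homogeneous_coeff[OF assms] by blast+
  then have "f = vscale (coeff (coeff (fst f) 0) 0) (1, 0) + vscale (coeff (coeff (snd f) 0) 0) (0, 1)"
    by (simp add: vscale_def prod_eq_iff)
  then show ?thesis by (rule that)
qed

lemma homogeneous_add: "f \<in> homogeneous n \<Longrightarrow> g \<in> homogeneous n \<Longrightarrow> f + g \<in> homogeneous n"
  by (simp add: homogeneous_def oplin)

lemma homogeneous_scale: "f \<in> homogeneous n \<Longrightarrow> vscale c f \<in> homogeneous n"
  by (simp add: homogeneous_def oplin mult.commute)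

lemma homogeneous_zero: "0 \<in> homogeneous n"
  by (simp add: homogeneous_def oplin)

lemma homogeneous_Z: "f \<in> homogeneous n \<Longrightarrow> Z f \<in> homogeneous (Suc n)"
  and homogeneous_Zb: "f \<in> homogeneous n \<Longrightarrow> Zb f \<in> homogeneous (Suc n)"
  by (simp_all add: homogeneous_def euler_Z euler_Zb oplin vs.scale_left_distrib add.commute)

lemma homogeneous_const: "(1, 0) \<in> homogeneous 0" "(0, 1) \<in> homogeneous 0"
  by (simp_all add: homogeneous_def euler_const)

lemma d_const_vec:
  "map_prod d_z d_z (1, 0) = 0" "map_prod d_z d_z (0, 1) = 0"
  "map_prod d_zb d_zb (1, 0) = 0" "map_prod d_zb d_zb (0, 1) = 0"
  by (simp_all add: zero_prod_def)

lemma euler_d: "euler (map_prod d_z d_z f) = map_prod d_z d_z (euler f) - map_prod d_z d_z f"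
  and euler_db: "euler (map_prod d_zb d_zb f) = map_prod d_zb d_zb (euler f) - map_prod d_zb d_zb f"
  by (induction f rule: vpoly_induct)
     (simp_all add: linop_rules[OF linop_d(1)] linop_rules[OF linop_d(2)] oplin euler_Z euler_Zb
        euler_const d_Z d_const_vec vs.scale_right_diff_distrib del: map_prod_simp)

text \<open>Euler's formula divided by n + 1. It uses the ordinary derivatives, so it holds for
  every \<kappa>, and it drives the inductions on the degree.\<close>

lemma homogeneous_Suc_split:
  assumes "f \<in> homogeneous (Suc n)"
  obtains g h where "g \<in> homogeneous n" "h \<in> homogeneous n" "f = Z g + Zb h"
proof -
  define c :: complex where "c = of_nat (Suc n)"
  have c: "c \<noteq> 0" "c = of_nat n + 1" unfolding c_def by (simp_all del: of_nat_Suc, simp)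
  have eq: "euler f = vscale c f"
    using assms unfolding homogeneous_def c_def by blast
  have d: "map_prod d_z d_z f \<in> homogeneous n" "map_prod d_zb d_zb f \<in> homogeneous n"
    by (simp_all add: homogeneous_def euler_d euler_db eq c(2) linop_rules[OF linop_d(1)]
          linop_rules[OF linop_d(2)] vs.scale_left_distrib)
  have "f = vscale (inverse c) (euler f)"
    unfolding eq using c(1) by simp
  then have "f = Z (vscale (inverse c) (map_prod d_z d_z f)) + Zb (vscale (inverse c) (map_prod d_zb d_zb f))"
    unfolding euler_def by (simp only: oplin)
  then show ?thesis
    using that d homogeneous_scale by blast
qed

lemma homogeneous_decomp:
  obtains F N where "\<And>n. F n \<in> homogeneous n" "f = (\<Sum>n<N. F n)"
proof -
  \<comment> \<open>The vanishing beyond N lets two decompositions be extended to a common length in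
    the additive case.\<close>
  have "\<exists>F N. (\<forall>n. F n \<in> homogeneous n) \<and> (\<forall>n\<ge>N. F n = 0) \<and> f = (\<Sum>n<N. F n)"
  proof (induction f rule: vpoly_induct)
    case t
    show ?case
      by (rule exI[of _ "\<lambda>n. if n = 0 then (1, 0) else 0"], rule exI[of _ 1])
         (simp add: homogeneous_const homogeneous_zero)
  next
    case tb
    show ?case
      by (rule exI[of _ "\<lambda>n. if n = 0 then (0, 1) else 0"], rule exI[of _ 1])
         (simp add: homogeneous_const homogeneous_zero)
  next
    case (add f g)
    then obtain F N G M where F: "\<forall>n. F n \<in> homogeneous n" "\<forall>n\<ge>N. F n = 0" "f = (\<Sum>n<N. F n)"
      and G: "\<forall>n. G n \<in> homogeneous n" "\<forall>n\<ge>M. G n = 0" "g = (\<Sum>n<M. G n)"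
      by blast
    have "f = (\<Sum>n<max N M. F n)" "g = (\<Sum>n<max N M. G n)"
      unfolding F(3) G(3) using F(2) G(2) by (intro sum.mono_neutral_left; simp)+
    then show ?case
      using F G
      by (intro exI[of _ "\<lambda>n. F n + G n"] exI[of _ "max N M"])
         (simp add: homogeneous_add sum.distrib)
  next
    case (scale c f)
    then obtain F N where F: "\<forall>n. F n \<in> homogeneous n" "\<forall>n\<ge>N. F n = 0" "f = (\<Sum>n<N. F n)"
      by blast
    then show ?case
      by (intro exI[of _ "\<lambda>n. vscale c (F n)"] exI[of _ N])
         (simp add: homogeneous_scale oplin)
  next
    case (Z f)
    then obtain F N where F: "\<forall>n. F n \<in> homogeneous n" "\<forall>n\<ge>N. F n = 0" "f = (\<Sum>n<N. F n)"
      by blast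
    then show ?case
      by (intro exI[of _ "\<lambda>n. case n of 0 \<Rightarrow> 0 | Suc k \<Rightarrow> Z (F k)"] exI[of _ "Suc N"])
         (auto simp: homogeneous_Z homogeneous_zero oplin sum.lessThan_Suc_shift Suc_le_eq
           simp del: sum.lessThan_Suc split: nat.split)
  next
    case (Zb f)
    then obtain F N where F: "\<forall>n. F n \<in> homogeneous n" "\<forall>n\<ge>N. F n = 0" "f = (\<Sum>n<N. F n)"
      by blast
    then show ?case
      by (intro exI[of _ "\<lambda>n. case n of 0 \<Rightarrow> 0 | Suc k \<Rightarrow> Zb (F k)"] exI[of _ "Suc N"])
         (auto simp: homogeneous_Zb homogeneous_zero oplin sum.lessThan_Suc_shift Suc_le_eq
           simp del: sum.lessThan_Suc split: nat.split)
  qed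
  then show ?thesis using that by blast
qed

section \<open>Commutation relations\<close>

locale vector_dunkl =
  fixes m l :: nat and \<kappa> :: real
  assumes l_pos: "1 \<le> l" and l_less: "2 * l < m"
begin

abbreviation "D \<equiv> dunkl m l \<kappa>"
abbreviation "Db \<equiv> dunkl_bar m l \<kappa>"
abbreviation "S \<equiv> refl_sum m l"

text \<open>In these four rules the weight collects a factor omega^j from the definition of
  \<open>Db\<close> and a factor omega^(-j) from the divided difference of zb f; for
  \<open>Db\<close> and zb the two cancel.\<close>

lemma D_Z: "D (Z f) = Z (D f) + f + vscale \<kappa> (S 0 f)"
  by (simp add: d_Z dunkl_def vdiv_diff_Z sum.distrib refl_sum_def oplin vs.scale_right_distrib algebra_simps)

lemma D_Zb: "D (Zb f) = Zb (D f) - vscale \<kappa> (S (-1) f)"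
  by (simp add: d_Z dunkl_def vdiv_diff_Zb sum_subtractf refl_sum_def oplin vs.scale_right_diff_distrib
        power_int_minus algebra_simps)

lemma Db_Z: "Db (Z f) = Z (Db f) - vscale \<kappa> (S 1 f)"
  by (simp add: d_Z dunkl_bar_def vdiv_diff_Z sum.distrib refl_sum_def oplin vs.scale_right_distrib
        del: vs.scale_scale)

lemma Db_Zb: "Db (Zb f) = Zb (Db f) + f + vscale \<kappa> (S 0 f)"
  by (simp add: d_Z dunkl_bar_def vdiv_diff_Zb sum_subtractf refl_sum_def oplin vs.scale_right_diff_distrib
        algebra_simps)

lemma D_const: "D (1, 0) = 0" "D (0, 1) = 0" "Db (1, 0) = 0" "Db (0, 1) = 0"
  by (simp_all add: dunkl_def dunkl_bar_def vdiv_diff_const d_const_vec del: map_prod_simp)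

lemmas S_Z = refl_sum_Z refl_sum_Zb refl_sum_t refl_sum_tb
lemmas comm_rules = D_Z D_Zb Db_Z Db_Zb D_const S_Z euler_Z euler_Zb euler_const

section \<open>Products of reflection sums, and equivariance and commutativity of the Dunkl
  operators\<close>

lemma root_sum_l: "root_sum m n = (if int m dvd n then of_nat m else 0)"
  using l_pos l_less by (intro root_sum_eq) simp

lemma root_sum_eq_0: "n \<noteq> 0 \<Longrightarrow> \<bar>n\<bar> < int m \<Longrightarrow> root_sum m n = 0"
  using dvd_imp_le_int[of n "int m"] by (auto simp: root_sum_l)

text \<open>Either product is m^2 if m divides both a and k, and 0 otherwise.\<close>

lemma root_sum_exchange: "root_sum m (k + a) * root_sum m (- a) = root_sum m a * root_sum m (k - a)"
  by (auto simp: root_sum_l dvd_add_left_iff dvd_diff_left_iff)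

text \<open>Both sides are a multiple of a sum over rotations. This is what makes the equivariance
  \<open>D_S\<close>, \<open>Db_S\<close> of the Dunkl operators provable by induction on \<open>f\<close>.\<close>

lemma S_exchange: "S (- i) (S (k + i) f) = S (k - i) (S i f)"
proof (induction f arbitrary: i rule: vpoly_induct)
  case t
  have "root_sum m (k + i + int l) * root_sum m (- i - int l) =
        root_sum m (i + int l) * root_sum m (k - i - int l)"
    using root_sum_exchange[of k "i + int l"] by (simp add: algebra_simps)
  then show ?case by (simp add: oplin S_Z)
next
  case tb
  have "root_sum m (k + i - int l) * root_sum m (- i + int l) =
        root_sum m (i - int l) * root_sum m (k - i + int l)"
    using root_sum_exchange[of k "i - int l"] by (simp add: algebra_simps)
  then show ?case by (simp add: oplin S_Z)
next
  case (Z f)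
  have "- (i + 1) = - i - 1" "k + (i + 1) = k + i + 1" "k - (i + 1) = k - i - 1" by simp_all
  then show ?case using Z[of "i + 1"] by (simp only: S_Z)
next
  case (Zb f)
  have "- (i - 1) = - i + 1" "k + (i - 1) = k + i - 1" "k - (i - 1) = k - i + 1" by simp_all
  then show ?case using Zb[of "i - 1"] by (simp only: S_Z)
qed (simp_all add: oplin)

text \<open>On t and tb the three root sums vanish together or all equal m; a factor z or zb only
  shifts k by one. The case k = 0 confines the eigenvalues of \<open>S 0\<close> to 0, m and
  -m.\<close>

lemma S_triple: "S k (S (- k) (S k f)) = vscale (of_nat m ^ 2) (S k f)"
proof (induction f arbitrary: k rule: vpoly_induct)
  case t
  have "int m dvd (- k - int l) \<longleftrightarrow> int m dvd (k + int l)"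
    using dvd_minus_iff[of "int m" "k + int l"] by simp
  then show ?case by (simp add: oplin S_Z root_sum_l power2_eq_square)
next
  case tb
  have "int m dvd (- k + int l) \<longleftrightarrow> int m dvd (k - int l)"
    using dvd_minus_iff[of "int m" "k - int l"] by simp
  then show ?case by (simp add: oplin S_Z root_sum_l power2_eq_square)
next
  case (Z f)
  show ?case using Z[of "k + 1"] by (simp add: S_Z oplin)
next
  case (Zb f)
  show ?case using Zb[of "k - 1"] by (simp add: S_Z oplin)
qed (simp_all add: oplin vs.scale_right_distrib mult.commute)

text \<open>Each reflection swaps z and zb up to a power of omega, so it turns \<open>Db\<close>
  into \<open>D\<close> up to that power, which lowers the weight.\<close>

lemma D_S: "D (S k f) = S (k - 1) (Db f)"
proof (induction f arbitrary: k rule: vpoly_induct)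
  case (Z f)
  then show ?case
    \<comment> \<open>The terms left over are \<kappa> times \<open>S (- 1) (S (k + 1) f)\<close>
      and \<open>S (k - 1) (S 1 f)\<close>.\<close>
    using S_exchange[of 1 k f] by (simp add: comm_rules oplin)
next
  case (Zb f)
  then show ?case
    using S_exchange[of 0 "k - 1" f] by (simp add: comm_rules oplin)
qed (simp_all add: oplin comm_rules)

lemma Db_S: "Db (S k f) = S (k + 1) (D f)"
proof (induction f arbitrary: k rule: vpoly_induct)
  case (Z f)
  then show ?case
    using S_exchange[of 0 "k + 1" f] by (simp add: comm_rules oplin)
next
  case (Zb f)
  then show ?case
    using S_exchange[of "-1" k f] by (simp add: comm_rules oplin)
qed (simp_all add: oplin comm_rules)

text \<open>In either order the \<kappa> terms cancel among themselves: for z f,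
  \<open>S 0 (Db f)\<close> against \<open>D (S 1 f)\<close>, and \<open>S 1 (D f)\<close> against
  \<open>Db (S 0 f)\<close>.\<close>

lemma dunkl_commute: "D (Db f) = Db (D f)"
proof (induction f rule: vpoly_induct)
  case (Z f)
  then show ?case by (simp add: comm_rules oplin D_S Db_S)
next
  case (Zb f)
  then show ?case by (simp add: comm_rules oplin D_S Db_S)
qed (simp_all add: oplin comm_rules)

lemma euler_S: "euler (S k f) = S k (euler f)"
  by (induction f arbitrary: k rule: vpoly_induct) (simp_all add: oplin comm_rules)

lemma euler_identity: "Z (D f) + Zb (Db f) = euler f - vscale \<kappa> (S 0 f)"
proof (induction f rule: vpoly_induct)
  case (add f g)
  then have "(Z (D f) + Zb (Db f)) + (Z (D g) + Zb (Db g)) =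
      (euler f - vscale \<kappa> (S 0 f)) + (euler g - vscale \<kappa> (S 0 g))" by (simp only:)
  then show ?case by (simp add: oplin algebra_simps)
next
  case (scale c f)
  then have "vscale c (Z (D f) + Zb (Db f)) = vscale c (euler f - vscale \<kappa> (S 0 f))" by (simp only:)
  then show ?case by (simp add: oplin vs.scale_right_distrib vs.scale_right_diff_distrib mult.commute)
next
  case (Z f)
  then have "Z (D f) = euler f - vscale \<kappa> (S 0 f) - Zb (Db f)" by (simp add: algebra_simps)
  then show ?case
    by (simp add: comm_rules oplin vmul_commute[of var_zb var_z])
next
  case (Zb f)
  then have "Z (D f) = euler f - vscale \<kappa> (S 0 f) - Zb (Db f)" by (simp add: algebra_simps)
  then show ?case
    by (simp add: comm_rules oplin vmul_commute[of var_z var_zb])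
\<comment> \<open>On t and tb the left side is 0, and \<open>S 0\<close> vanishes there because 0 <
  l < m.\<close>
qed (use l_pos l_less in \<open>simp_all add: oplin comm_rules root_sum_eq_0\<close>)

lemma euler_eq: "euler f = Z (D f) + Zb (Db f) + vscale \<kappa> (S 0 f)"
  by (simp add: euler_identity)

text \<open>Writing \<open>euler\<close> through \<open>Z\<close>, \<open>Zb\<close>,
  \<open>D\<close>, \<open>Db\<close> and \<open>S 0\<close> reduces the degree shift to the
  commutators; the divided differences need no degree count of their own.\<close>

lemma euler_D: "euler (D f) = D (euler f) - D f"
  unfolding euler_eq
  by (simp add: comm_rules oplin D_S dunkl_commute vs.scale_right_distrib)

lemma euler_Db: "euler (Db f) = Db (euler f) - Db f"
  unfolding euler_eq
  by (simp add: comm_rules oplin Db_S dunkl_commute vs.scale_right_distrib)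

lemma homogeneous_D: "f \<in> homogeneous (Suc n) \<Longrightarrow> D f \<in> homogeneous n"
  and homogeneous_Db: "f \<in> homogeneous (Suc n) \<Longrightarrow> Db f \<in> homogeneous n"
  by (simp_all add: homogeneous_def euler_D euler_Db oplin vs.scale_left_distrib)

lemma homogeneous_0_D:
  assumes "f \<in> homogeneous 0" shows "D f = 0" and "Db f = 0"
proof -
  obtain a b where "f = vscale a (1, 0) + vscale b (0, 1)" using homogeneous_0_const[OF assms] .
  then show "D f = 0" "Db f = 0" by (simp_all add: oplin D_const)
qed

lemma homogeneous_S: "f \<in> homogeneous n \<Longrightarrow> S k f \<in> homogeneous n"
  by (simp add: homogeneous_def euler_S oplin)

text \<open>Splitting off z or zb changes k by one and n by one, which preserves the bound. At n = 0
  the exponents k + l and k - l are nonzero and of modulus below 2 l < m.\<close>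

lemma S_low_degree:
  assumes "f \<in> homogeneous n" and "\<bar>k\<bar> + int n < int l"
  shows "S k f = 0"
  using assms
proof (induction n arbitrary: f k)
  case 0
  have "root_sum m (k + int l) = 0" "root_sum m (k - int l) = 0"
    using 0(2) l_less by (intro root_sum_eq_0; linarith)+
  moreover obtain a b where "f = vscale a (1, 0) + vscale b (0, 1)"
    using homogeneous_0_const[OF 0(1)] .
  ultimately show ?case by (simp add: oplin S_Z)
next
  case (Suc n)
  from homogeneous_Suc_split[OF Suc.prems(1)] obtain g h
    where gh: "g \<in> homogeneous n" "h \<in> homogeneous n" "f = Z g + Zb h" by blast
  have "S (k + 1) g = 0" "S (k - 1) h = 0"
    using Suc.prems(2) by (intro Suc.IH gh; simp)+
  then show ?case by (simp add: gh(3) oplin S_Z)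
qed

section \<open>The contravariant form\<close>

abbreviation "B \<equiv> cform m l \<kappa>"

definition star_term :: "bipoly \<Rightarrow> vpoly \<Rightarrow> nat \<Rightarrow> nat \<Rightarrow> vpoly" where
  "star_term p q k j =
     vscale (cnj (coeff (coeff p k) j) * 2 ^ (j + k)) ((D ^^ j) ((Db ^^ k) q))"

text \<open>The defining range depends on p; a common rectangle makes the sums for different p
  comparable, the added terms being 0.\<close>

lemma star_op_eq:
  assumes "degree p \<le> N" and "\<And>k. degree (coeff p k) \<le> M"
  shows "star_op m l \<kappa> p q = (\<Sum>k\<le>N. \<Sum>j\<le>M. star_term p q k j)"
proof -
  have "(\<Sum>j\<le>degree (coeff p k). star_term p q k j) = (\<Sum>j\<le>M. star_term p q k j)" for k
    using assms(2)[of k] by (intro sum.mono_neutral_left) (auto simp: star_term_def coeff_eq_0)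
  then have "star_op m l \<kappa> p q = (\<Sum>k\<le>degree p. \<Sum>j\<le>M. star_term p q k j)"
    by (simp add: star_op_def star_term_def)
  also have "\<dots> = (\<Sum>k\<le>N. \<Sum>j\<le>M. star_term p q k j)"
    using assms(1) by (intro sum.mono_neutral_left) (auto simp: star_term_def coeff_eq_0)
  finally show ?thesis .
qed

lemma coeff_degree_bound:
  fixes p :: bipoly
  obtains M where "\<And>k. degree (coeff p k) \<le> M"
proof (rule that)
  fix k
  show "degree (coeff p k) \<le> (\<Sum>k\<le>degree p. degree (coeff p k))"
  proof (cases "k \<le> degree p")
    case True
    then show ?thesis by (intro member_le_sum) auto
  qed (simp add: coeff_eq_0)
qed

lemma star_op_add: "star_op m l \<kappa> (p + p') q = star_op m l \<kappa> p q + star_op m l \<kappa> p' q"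
proof -
  obtain M M' where M: "degree (coeff p k) \<le> M" "degree (coeff p' k) \<le> M'" for k
    using coeff_degree_bound by metis
  define N where "N = max (degree p) (degree p')"
  define L where "L = max M M'"
  have d: "degree p \<le> N" "degree p' \<le> N" "degree (p + p') \<le> N"
    by (simp_all add: N_def degree_add_le_max)
  have b: "degree (coeff p k) \<le> L" "degree (coeff p' k) \<le> L" for k
    using M[of k] by (simp_all add: L_def le_max_iff_disj)
  then have b': "degree (coeff (p + p') k) \<le> L" for k
    by (simp add: degree_add_le)
  have "star_term (p + p') q k j = star_term p q k j + star_term p' q k j" for k j
    by (simp add: star_term_def distrib_right vs.scale_left_distrib)
  then show ?thesis
    by (simp add: star_op_eq[OF d(1) b(1)] star_op_eq[OF d(2) b(2)] star_op_eq[OF d(3) b'] sum.distrib)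
qed

lemma star_op_scale: "star_op m l \<kappa> (const2 c * p) q = vscale (cnj c) (star_op m l \<kappa> p q)"
proof -
  obtain M where M: "degree (coeff p k) \<le> M" for k
    using coeff_degree_bound by metis
  have b: "degree (coeff (const2 c * p) k) \<le> M" for k
    using M[of k] by (simp add: const2_def)
  have d: "degree (const2 c * p) \<le> degree p"
    by (simp add: const2_def degree_smult_le)
  have "star_term (const2 c * p) q k j = vscale (cnj c) (star_term p q k j)" for k j
    by (simp add: star_term_def mult.assoc)
  then show ?thesis
    by (simp add: star_op_eq[OF order_refl M] star_op_eq[OF d b] vs.scale_sum_right)
qed

lemma D_funpow_Db: "D ((Db ^^ k) q) = (Db ^^ k) (D q)"
  by (induction k) (simp_all add: dunkl_commute)

text \<open>The additional \<open>D\<close> reaches q only by passing the powers of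
  \<open>Db\<close>, so adjointness rests on commutativity of the Dunkl operators.\<close>

lemma star_op_var_z: "star_op m l \<kappa> (var_z * p) q = vscale 2 (star_op m l \<kappa> p (D q))"
proof -
  obtain M where M: "degree (coeff p k) \<le> M" for k
    using coeff_degree_bound by metis
  have b: "degree (coeff (var_z * p) k) \<le> Suc M" for k
    using M[of k] by (simp add: var_z_mult degree_pCons_le[THEN order_trans])
  have d: "degree (var_z * p) \<le> degree p"
    by (simp add: var_z_mult degree_smult_le)
  have "star_term (var_z * p) q k 0 = 0"
    and "star_term (var_z * p) q k (Suc j) = vscale 2 (star_term p (D q) k j)" for k j
    by (simp_all add: star_term_def var_z_mult mult_ac D_funpow_Db funpow_swap1[of D])
  then show ?thesis
    unfolding star_op_eq[OF order_refl M] star_op_eq[OF d b] sum.atMost_Suc_shift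
    by (simp add: vs.scale_sum_right)
qed

lemma star_op_var_zb: "star_op m l \<kappa> (var_zb * p) q = vscale 2 (star_op m l \<kappa> p (Db q))"
proof -
  obtain M where M: "degree (coeff p k) \<le> M" for k
    using coeff_degree_bound by metis
  have b: "degree (coeff (var_zb * p) k) \<le> M" for k
    using M[of "k - 1"] by (cases k) (simp_all add: var_zb_mult)
  have d: "degree (var_zb * p) \<le> Suc (degree p)"
    by (simp add: var_zb_mult degree_pCons_le)
  have "star_term (var_zb * p) q 0 j = 0"
    and "star_term (var_zb * p) q (Suc k) j = vscale 2 (star_term p (Db q) k j)" for k j
    by (simp_all add: star_term_def var_zb_mult mult_ac funpow_swap1[of Db])
  then show ?thesis
    unfolding star_op_eq[OF order_refl M] star_op_eq[OF d b] sum.atMost_Suc_shift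
    by (simp add: vs.scale_sum_right)
qed

lemma star_op_const: "star_op m l \<kappa> 0 q = 0" "star_op m l \<kappa> 1 q = q"
  by (simp_all add: star_op_def)

lemma linop_star_op: "linop (star_op m l \<kappa> p)"
  unfolding star_op_def
  by (intro linop_sum_ops linop_comp[OF linop_vscale] linop_comp[OF linop_funpow linop_funpow]
      linop_dunkl linop_dunkl_bar)

lemma eval0_eq: "eval0 p = coeff (coeff p 0) 0"
  by (simp add: eval0_def poly_0_coeff_0)

lemma B_eq:
  "B f g = 2 * eval0 (fst (star_op m l \<kappa> (fst f) g)) + 2 * eval0 (snd (star_op m l \<kappa> (snd f) g))"
  by (simp add: cform_def tform_def)

lemma eval0_simps: "eval0 (p + q) = eval0 p + eval0 q" "eval0 (const2 c * p) = c * eval0 p"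
  by (simp_all add: eval0_eq)

lemma B_add_left: "B (f + f') g = B f g + B f' g"
  by (simp add: B_eq star_op_add eval0_simps algebra_simps)

lemma B_scale_left: "B (vscale c f) g = cnj c * B f g"
  by (simp add: B_eq vscale_def star_op_scale eval0_simps algebra_simps)

lemma B_add_right: "B f (g + g') = B f g + B f g'"
  by (simp add: B_eq linop_add[OF linop_star_op] eval0_simps algebra_simps)

lemma B_scale_right: "B f (vscale c g) = c * B f g"
  by (simp add: B_eq linop_scale[OF linop_star_op])
     (simp add: vscale_def eval0_simps algebra_simps)

lemma B_zero: "B 0 g = 0" "B f 0 = 0"
  using B_scale_left[of 0 0 g] B_scale_right[of f 0 0] by simp_all

lemma B_sum_left: "B (sum F A) g = (\<Sum>x\<in>A. B (F x) g)"
  by (induction A rule: infinite_finite_induct) (simp_all add: B_zero B_add_left)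

lemma B_sum_right: "B f (sum F A) = (\<Sum>x\<in>A. B f (F x))"
  by (induction A rule: infinite_finite_induct) (simp_all add: B_zero B_add_right)

lemma B_Z: "B (Z f) g = 2 * B f (D g)"
  by (simp add: B_eq vmul_def star_op_var_z vscale_def eval0_simps algebra_simps)

lemma B_Zb: "B (Zb f) g = 2 * B f (Db g)"
  by (simp add: B_eq vmul_def star_op_var_zb vscale_def eval0_simps algebra_simps)

lemma B_const: "B (1, 0) g = 2 * eval0 (fst g)" "B (0, 1) g = 2 * eval0 (snd g)"
  by (simp_all add: B_eq star_op_const eval0_eq)

lemmas B_rules = B_add_left B_scale_left B_add_right B_scale_right B_zero B_Z B_Zb B_const

lemma fst_vmul: "fst (vmul p f) = p * fst f" "snd (vmul p f) = p * snd f"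
  by (simp_all add: vmul_def)

lemma fst_vscale: "fst (vscale c f) = const2 c * fst f" "snd (vscale c f) = const2 c * snd f"
  by (simp_all add: vscale_def)

text \<open>Multiples of z and zb have no constant term, and neither do their reflections. This
  serves the base case of \<open>B_S\<close>.\<close>

lemma eval0_S:
  "eval0 (fst (S k g)) = root_sum m (k - int l) * eval0 (snd g)"
  "eval0 (snd (S k g)) = root_sum m (k + int l) * eval0 (fst g)"
proof -
  have "eval0 (var_z * p) = 0" "eval0 (var_zb * p) = 0" for p
    by (simp_all add: eval0_eq var_z_mult var_zb_mult)
  moreover have "eval0 0 = 0" "eval0 1 = 1" "eval0 (const2 c) = c" for c
    by (simp_all add: eval0_eq const2_def)
  ultimately have "eval0 (fst (S k g)) = root_sum m (k - int l) * eval0 (snd g) \<and>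
        eval0 (snd (S k g)) = root_sum m (k + int l) * eval0 (fst g)"
    by (induction g arbitrary: k rule: vpoly_induct)
       (simp_all add: oplin S_Z fst_vmul fst_vscale eval0_simps distrib_left mult.left_commute)
  then show "eval0 (fst (S k g)) = root_sum m (k - int l) * eval0 (snd g)"
    "eval0 (snd (S k g)) = root_sum m (k + int l) * eval0 (fst g)" by simp_all
qed

lemma cnj_root_sum: "cnj (root_sum m k) = root_sum m (- k)"
  by (simp add: root_sum_l)

text \<open>Adjointness moves z or zb onto g as a Dunkl operator, and equivariance carries that
  operator past \<open>S\<close>. For k = 0 this makes \<open>S 0\<close> self-adjoint.\<close>

lemma B_S: "B (S k f) g = B f (S (- k) g)"
proof (induction f arbitrary: k g rule: vpoly_induct)
  case (Z f)
  show ?case using Z[of "k + 1" "Db g"] by (simp add: B_rules S_Z D_S)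
next
  case (Zb f)
  show ?case using Zb[of "k - 1" "D g"] by (simp add: B_rules S_Z Db_S)
qed (simp_all add: B_rules oplin S_Z eval0_S cnj_root_sum)

text \<open>Adjointness lowers both degrees together, until either the left side is constant and g
  has no constant term, or g is constant and killed by \<open>D\<close> and
  \<open>Db\<close>.\<close>

lemma B_orthogonal:
  assumes "f \<in> homogeneous n" "g \<in> homogeneous n'" "n \<noteq> n'"
  shows "B f g = 0"
  using assms
proof (induction n arbitrary: f g n')
  case 0
  have "eval0 (fst g) = 0" "eval0 (snd g) = 0"
    using homogeneous_coeff[OF 0(2), of 0 0] 0(3) by (simp_all add: eval0_eq)
  moreover obtain a b where "f = vscale a (1, 0) + vscale b (0, 1)"
    using homogeneous_0_const[OF 0(1)] .
  ultimately show ?case by (simp add: B_rules)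
next
  case (Suc n)
  from homogeneous_Suc_split[OF Suc.prems(1)] obtain g' h
    where gh: "g' \<in> homogeneous n" "h \<in> homogeneous n" "f = Z g' + Zb h" by blast
  have "B g' (D g) = 0 \<and> B h (Db g) = 0"
  proof (cases n')
    case 0
    with Suc.prems(2) show ?thesis by (simp add: homogeneous_0_D B_zero)
  next
    case (Suc i)
    with Suc.prems Suc.IH gh show ?thesis by (metis homogeneous_D homogeneous_Db)
  qed
  then show ?case by (simp add: gh(3) B_rules)
qed

lemma B_eigen_orthogonal:
  assumes "S 0 f = vscale (of_real a) f" "S 0 g = vscale (of_real b) g" "a \<noteq> b"
  shows "B f g = 0"
  using B_S[of 0 f g] assms by (simp add: B_rules)

lemma homogeneous_diff: "f \<in> homogeneous n \<Longrightarrow> g \<in> homogeneous n \<Longrightarrow> f - g \<in> homogeneous n"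
  by (simp add: homogeneous_def oplin vs.scale_right_diff_distrib)

section \<open>Positivity\<close>

text \<open>The clauses without f \<noteq> 0 also cover the zero vector, because one of
  \<open>D f\<close>, \<open>Db f\<close> may vanish in the induction.\<close>

definition pos_at :: "vpoly \<Rightarrow> bool" where
  "pos_at f \<longleftrightarrow> B f f \<in> \<real> \<and> 0 \<le> Re (B f f) \<and> (f \<noteq> 0 \<longrightarrow> 0 < Re (B f f))"

lemma pos_at_zero: "pos_at 0"
  by (simp add: pos_at_def B_zero)

lemma pos_at_eigen:
  assumes "\<bar>\<kappa>\<bar> * m < l" and f: "f \<in> homogeneous (Suc n)" and eig: "S 0 f = vscale (of_real a) f"
    and a: "\<bar>a\<bar> \<le> m" and IH: "pos_at (D f)" "pos_at (Db f)"
  shows "pos_at f"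
proof (cases "f = 0")
  case False
  define r where "r = real (Suc n) - \<kappa> * a"
  have r: "r > 0"
  proof (cases "Suc n < l")
    case True
    then have "S 0 f = 0" using S_low_degree[OF f, of 0] by simp
    with eig False have "a = 0" by simp
    then show ?thesis by (simp add: r_def)
  next
    case n: False
    have "\<kappa> * a \<le> \<bar>\<kappa>\<bar> * \<bar>a\<bar>" by (metis abs_ge_self abs_mult)
    also have "\<dots> \<le> \<bar>\<kappa>\<bar> * m" by (intro mult_left_mono a) simp
    finally show ?thesis using n assms(1) by (simp add: r_def)
  qed
  have eq: "Z (D f) + Zb (Db f) = vscale (of_real r) f"
    using f by (simp add: euler_identity homogeneous_def eig r_def vs.scale_left_diff_distrib)
  have "of_real r * B f f = B (Z (D f) + Zb (Db f)) f"
    unfolding eq B_rules by simp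
  also have "\<dots> = 2 * B (D f) (D f) + 2 * B (Db f) (Db f)"
    by (simp add: B_rules)
  finally have B: "of_real r * B f f = 2 * B (D f) (D f) + 2 * B (Db f) (Db f)" .
  obtain x y where xy: "B (D f) (D f) = of_real x" "B (Db f) (Db f) = of_real y"
    using IH by (auto simp: pos_at_def elim!: Reals_cases)
  \<comment> \<open>If both vanished, the Euler identity would give r f = 0.\<close>
  have "D f \<noteq> 0 \<or> Db f \<noteq> 0"
    using eq False r by (auto simp: oplin)
  then have "0 < 2 * x + 2 * y"
    using IH unfolding pos_at_def xy by auto
  moreover have "B f f = of_real ((2 * x + 2 * y) / r)"
    using B r by (simp add: xy field_simps)
  ultimately show ?thesis
    using r unfolding pos_at_def by (simp del: of_real_divide of_real_add)
qed (simp add: pos_at_zero)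

text \<open>The projections are the Lagrange polynomials (x^2 + m x) / (2 m^2), (x^2 - m x) / (2
  m^2) and 1 - x^2 / m^2 for the nodes m, -m, 0, taken at \<open>S 0\<close>. They preserve the
  degree, so each component falls under \<open>pos_at_eigen\<close>.\<close>

lemma pos_at_homogeneous:
  assumes "\<bar>\<kappa>\<bar> * m < l" and "f \<in> homogeneous n"
  shows "pos_at f"
  using assms(2)
proof (induction n arbitrary: f)
  case 0
  obtain a b where f: "f = vscale a (1, 0) + vscale b (0, 1)" using homogeneous_0_const[OF 0] .
  have "B f f = of_real (2 * (cmod a)\<^sup>2 + 2 * (cmod b)\<^sup>2)"
  proof -
    have "B f f = 2 * (a * cnj a) + 2 * (b * cnj b)"
      by (simp add: f B_rules) (simp add: eval0_eq vscale_def const2_def)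
    then show ?thesis
      by (simp only: complex_norm_square[symmetric] of_real_add of_real_mult of_real_numeral)
  qed
  moreover have "0 < (cmod a)\<^sup>2 + (cmod b)\<^sup>2" if "f \<noteq> 0"
    using that by (auto simp: f sum_power2_gt_zero_iff)
  ultimately show ?case
    by (auto simp: pos_at_def simp del: of_real_add)
next
  case (Suc n)
  have m0: "real m \<noteq> 0" using l_less by simp
  \<comment> \<open>\<open>u, v, w\<close> are the components of \<open>f\<close> in the eigenspaces of \<open>S 0\<close> for \<open>m, -m, 0\<close>,
    obtained from \<open>(S 0)^3 = m^2 S 0\<close>.\<close>
  define c where "c = inverse (2 * (complex_of_nat m)\<^sup>2)"
  have c: "c * (2 * (complex_of_nat m)\<^sup>2) = 1" using m0 by (simp add: c_def)
  define u where "u = vscale c (S 0 (S 0 f) + vscale (of_nat m) (S 0 f))"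
  define v where "v = vscale c (S 0 (S 0 f) - vscale (of_nat m) (S 0 f))"
  define w where "w = f - vscale (2 * c) (S 0 (S 0 f))"
  have S3: "S 0 (S 0 (S 0 f)) = vscale ((of_nat m)\<^sup>2) (S 0 f)"
    using S_triple[of 0 f] by simp
  have Su: "S 0 u = vscale (of_real (real m)) u"
    by (simp add: u_def oplin S3 vs.scale_right_distrib power2_eq_square mult_ac add.commute)
  have Sv: "S 0 v = vscale (of_real (- real m)) v"
    by (simp add: v_def oplin S3 vs.scale_right_diff_distrib power2_eq_square mult_ac)
  have "2 * c * (of_nat m)\<^sup>2 = 1" using c by (simp add: mult_ac)
  then have Sw: "S 0 w = vscale (of_real 0) w"
    by (simp add: w_def oplin S3 mult_ac)
  have hom: "u \<in> homogeneous (Suc n)" "v \<in> homogeneous (Suc n)" "w \<in> homogeneous (Suc n)"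
    unfolding u_def v_def w_def
    by (intro homogeneous_add homogeneous_diff homogeneous_scale homogeneous_S Suc.prems)+
  have "vscale (2 * c) g = vscale c g + vscale c g" for g
    by (simp only: mult_2 vs.scale_left_distrib)
  then have f: "f = u + v + w"
    by (simp add: u_def v_def w_def vs.scale_right_distrib vs.scale_right_diff_distrib)
  have "pos_at g" if "g \<in> homogeneous (Suc n)" "S 0 g = vscale (of_real a) g" "\<bar>a\<bar> \<le> m" for g a
    by (rule pos_at_eigen[OF assms(1) that]) (intro Suc.IH homogeneous_D homogeneous_Db that(1))+
  note pos = this[OF hom(1) Su] this[OF hom(2) Sv] this[OF hom(3) Sw]
  have "B u v = 0" "B v u = 0" "B u w = 0" "B w u = 0" "B v w = 0" "B w v = 0"
    using m0 B_eigen_orthogonal[OF Su Sv] B_eigen_orthogonal[OF Sv Su] B_eigen_orthogonal[OF Su Sw]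
      B_eigen_orthogonal[OF Sw Su] B_eigen_orthogonal[OF Sv Sw] B_eigen_orthogonal[OF Sw Sv]
    by simp_all
  then have B: "B f f = B u u + B v v + B w w"
    by (simp add: f B_rules)
  have "f \<noteq> 0 \<Longrightarrow> u \<noteq> 0 \<or> v \<noteq> 0 \<or> w \<noteq> 0" by (auto simp: f)
  then show ?case
    using pos unfolding pos_at_def B by (auto intro!: Reals_add)
qed

lemma B_positive:
  assumes "\<bar>\<kappa>\<bar> * m < l"
  shows "pos_def_on UNIV B"
  unfolding pos_def_on_def
proof (intro ballI impI)
  fix f :: vpoly
  assume "f \<noteq> 0"
  obtain F N where F: "\<And>n. F n \<in> homogeneous n" and f: "f = (\<Sum>n<N. F n)"
    using homogeneous_decomp by blast
  have "B f f = (\<Sum>i<N. \<Sum>n<N. B (F i) (F n))"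
    by (simp only: f B_sum_left) (simp only: B_sum_right)
  also have "\<dots> = (\<Sum>i<N. \<Sum>n<N. if n = i then B (F i) (F i) else 0)"
    by (intro sum.cong refl) (auto intro: B_orthogonal[OF F F])
  finally have B: "B f f = (\<Sum>n<N. B (F n) (F n))" by simp
  have pos: "pos_at (F n)" for n by (rule pos_at_homogeneous[OF assms F])
  obtain n where n: "n < N" "F n \<noteq> 0"
    using \<open>f \<noteq> 0\<close> f by (metis lessThan_iff sum.neutral)
  have "0 < (\<Sum>n<N. Re (B (F n) (F n)))"
    using pos n by (intro sum_pos2[of _ n]) (auto simp: pos_at_def)
  then show "B f f \<in> \<real> \<and> 0 < Re (B f f)"
    using pos by (auto simp: B pos_at_def intro!: sum_in_Reals)
qed

section \<open>Necessity of the bound\<close>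

abbreviation "zb_t n \<equiv> (Zb ^^ n) (1, 0)"
abbreviation "z_tb n \<equiv> (Z ^^ n) (0, 1)"

text \<open>At k = 0 and n = l the coefficient is m, so \<open>S 0\<close> exchanges zb^l t and z^l
  tb up to the factor m. Their sum and difference are the eigenvectors for m and -m used as
  witnesses.\<close>

lemma S_zb_t: "S k (zb_t n) = vscale (root_sum m (k - int n + int l)) (z_tb n)"
  by (induction n arbitrary: k) (simp_all add: S_Z oplin algebra_simps)

lemma S_z_tb: "S k (z_tb n) = vscale (root_sum m (k + int n - int l)) (zb_t n)"
  by (induction n arbitrary: k) (simp_all add: S_Z oplin algebra_simps)

text \<open>The exponent in the correction stays strictly between 0 and m, so \<open>D\<close> acts
  here like the ordinary derivative. For n = l the exponent 0 appears, the source of the \<kappa> m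
  in \<open>D_zb_t_l\<close>.\<close>

lemma D_zb_t_0: "n < l \<Longrightarrow> D (zb_t n) = 0"
proof (induction n)
  case (Suc n)
  then have "root_sum m (- 1 - int n + int l) = 0"
    using l_less by (intro root_sum_eq_0) auto
  with Suc show ?case by (simp add: D_Zb S_zb_t oplin)
qed (simp add: D_const)

lemma Db_z_tb_0: "n < l \<Longrightarrow> Db (z_tb n) = 0"
proof (induction n)
  case (Suc n)
  then have "root_sum m (1 + int n - int l) = 0"
    using l_less by (intro root_sum_eq_0) auto
  with Suc show ?case by (simp add: Db_Z S_z_tb oplin)
qed (simp add: D_const)

lemma Db_zb_t: "n \<le> l \<Longrightarrow> Db (zb_t n) = vscale (of_nat n) (zb_t (n - 1))"
proof (induction n)
  case (Suc n)
  then have "root_sum m (0 - int n + int l) = 0"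
    using l_less by (intro root_sum_eq_0) auto
  moreover have "Zb (vscale (of_nat n) (zb_t (n - 1))) = vscale (of_nat n) (zb_t n)"
    by (cases n) (simp_all add: oplin)
  ultimately show ?case
    using Suc by (simp add: Db_Zb S_zb_t vs.scale_left_distrib add.commute)
qed (simp add: D_const)

lemma D_z_tb: "n \<le> l \<Longrightarrow> D (z_tb n) = vscale (of_nat n) (z_tb (n - 1))"
proof (induction n)
  case (Suc n)
  then have "root_sum m (0 + int n - int l) = 0"
    using l_less by (intro root_sum_eq_0) auto
  moreover have "Z (vscale (of_nat n) (z_tb (n - 1))) = vscale (of_nat n) (z_tb n)"
    by (cases n) (simp_all add: oplin)
  ultimately show ?case
    using Suc by (simp add: D_Z S_z_tb vs.scale_left_distrib add.commute)
qed (simp add: D_const)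

lemma D_zb_t_l: "D (zb_t l) = - vscale (of_real (\<kappa> * m)) (z_tb (l - 1))"
proof -
  obtain i where i: "l = Suc i" using l_pos by (cases l) auto
  have "root_sum m (- 1 - int i + int l) = of_nat m" "i < l" by (simp_all add: i root_sum_l)
  moreover have eq: "zb_t l = Zb (zb_t i)" "l - 1 = i" by (simp_all add: i)
  ultimately show ?thesis
    unfolding eq by (simp add: D_zb_t_0 D_Zb S_zb_t oplin)
qed

lemma Db_z_tb_l: "Db (z_tb l) = - vscale (of_real (\<kappa> * m)) (zb_t (l - 1))"
proof -
  obtain i where i: "l = Suc i" using l_pos by (cases l) auto
  have "root_sum m (1 + int i - int l) = of_nat m" "i < l" by (simp_all add: i root_sum_l)
  moreover have eq: "z_tb l = Z (z_tb i)" "l - 1 = i" by (simp_all add: i)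
  ultimately show ?thesis
    unfolding eq by (simp add: Db_z_tb_0 Db_Z S_z_tb oplin)
qed

text \<open>One factor 2 is the square norm of t, n more come from adjointness, and the factorial
  from differentiating zb^n.\<close>

lemma B_zb_t: "n \<le> l \<Longrightarrow> B (zb_t n) (zb_t n) = of_real (2 ^ Suc n * fact n)"
proof (induction n)
  case (Suc n)
  then show ?case
    using Db_zb_t[of "Suc n"] by (simp add: B_rules mult_ac del: of_nat_Suc)
qed (simp add: B_rules eval0_eq)

lemma B_z_tb: "n \<le> l \<Longrightarrow> B (z_tb n) (z_tb n) = of_real (2 ^ Suc n * fact n)"
proof (induction n)
  case (Suc n)
  then show ?case
    using D_z_tb[of "Suc n"] by (simp add: B_rules mult_ac del: of_nat_Suc)
qed (simp add: B_rules eval0_eq)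

lemma B_witness:
  fixes s :: real
  assumes "s\<^sup>2 = 1"
  defines "f \<equiv> zb_t l + vscale (of_real s) (z_tb l)"
  shows "f \<in> harmonics m l \<kappa>" and "f \<noteq> 0"
    and "B f f = of_real (4 * 2 ^ l * fact (l - 1) * (l - s * (\<kappa> * m)))"
proof -
  obtain i where i: "l = Suc i" using l_pos by (cases l) auto
  show "f \<in> harmonics m l \<kappa>"
    using D_zb_t_0[of "l - 1"] l_pos
    by (simp add: harmonics_def f_def oplin Db_zb_t Db_z_tb_l)
  have "fst (zb_t n) \<noteq> 0" "fst (z_tb n) = 0" for n
    by (induction n) (simp_all add: fst_vmul var_zb_def)
  then have "fst f \<noteq> 0"
    by (simp add: f_def fst_vscale)
  then show "f \<noteq> 0" by auto
  have il: "l - 1 = i" by (simp add: i)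
  \<comment> \<open>The common square norm of zb^(l-1) t and z^(l-1) tb. The diagonal terms of
    \<open>B f f\<close> are 2 l A each, the cross terms -2 s \<kappa> m A each.\<close>
  define A :: real where "A = 2 ^ Suc i * fact i"
  have A: "B (zb_t i) (zb_t i) = of_real A" "B (z_tb i) (z_tb i) = of_real A"
    using B_zb_t[of i] B_z_tb[of i] i unfolding A_def by auto
  have fl: "2 ^ Suc l * fact l = 2 * l * A" by (simp add: A_def i)
  have "B (zb_t l) (zb_t l) = of_real (2 * l * A)" "B (z_tb l) (z_tb l) = of_real (2 * l * A)"
    using B_zb_t[of l] B_z_tb[of l] by (simp_all only: fl order_refl)
  moreover have "B (zb_t l) (z_tb l) = B (Zb (zb_t i)) (z_tb l)"
    "B (z_tb l) (zb_t l) = B (Z (z_tb i)) (zb_t l)" by (simp_all add: i)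
  then have "B (zb_t l) (z_tb l) = of_real (- 2 * (\<kappa> * m) * A)" "B (z_tb l) (zb_t l) = of_real (- 2 * (\<kappa> * m) * A)"
    unfolding B_rules D_zb_t_l Db_z_tb_l
    \<comment> \<open>The minus sign is moved into the scalar, where the scaling rule of
      \<open>B\<close> applies.\<close>
    unfolding vs.scale_minus_left[symmetric] B_rules il A by simp_all
  ultimately have "B f f = of_real (2 * l * A + s\<^sup>2 * (2 * l * A) - s * (4 * (\<kappa> * m) * A))"
    by (simp add: f_def B_rules power2_eq_square algebra_simps)
  also have "2 * l * A + s\<^sup>2 * (2 * l * A) - s * (4 * (\<kappa> * m) * A) = 4 * 2 ^ l * fact (l - 1) * (l - s * (\<kappa> * m))"
    by (simp add: assms(1) A_def i algebra_simps)
  finally show "B f f = of_real (4 * 2 ^ l * fact (l - 1) * (l - s * (\<kappa> * m)))" .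
qed

lemma range_if_positive:
  assumes "pos_def_on (harmonics m l \<kappa>) B"
  shows "\<bar>\<kappa>\<bar> * m < l"
proof -
  have "0 < l - s * (\<kappa> * m)" if "s\<^sup>2 = 1" for s :: real
  proof -
    have "0 < 4 * 2 ^ l * fact (l - 1) * (l - s * (\<kappa> * m))"
      using assms B_witness[OF that] unfolding pos_def_on_def by (metis Re_complex_of_real)
    then show ?thesis by (rule zero_less_mult_pos) simp
  qed
  from this[of 1] this[of "-1"] show ?thesis by (simp add: abs_if)
qed

section \<open>The Gaussian form\<close>

abbreviation "L \<equiv> dunkl_laplace m l \<kappa>"

lemma linop_L: "linop L"
  unfolding dunkl_laplace_def
  by (intro linop_comp[OF linop_vscale] linop_comp[OF linop_dunkl] linop_dunkl_bar)

text \<open>Each step lowers the degree by two or yields 0, so the bound is generous; it keeps the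
  induction on N simple.\<close>

lemma L_funpow_homogeneous: "f \<in> homogeneous n \<Longrightarrow> n < N \<Longrightarrow> (L ^^ N) f = 0"
proof (induction N arbitrary: f n)
  case (Suc N)
  have "(L ^^ N) (L f) = 0"
  proof (cases "n < 2")
    case True
    then have "D (Db f) = 0"
      using Suc.prems(1) homogeneous_0_D homogeneous_Db[of f 0] linop_zero[OF linop_dunkl]
      by (metis One_nat_def less_2_cases)
    then show ?thesis
      by (simp add: dunkl_laplace_def linop_zero[OF linop_funpow[OF linop_L]])
  next
    case False
    then obtain i where i: "n = Suc (Suc i)" by (metis add_2_eq_Suc le_Suc_ex not_less)
    then have "L f \<in> homogeneous i"
      using Suc.prems(1) by (simp add: dunkl_laplace_def homogeneous_scale homogeneous_D homogeneous_Db)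
    then show ?thesis using Suc.IH Suc.prems(2) i by simp
  qed
  then show ?case by (simp add: funpow_swap1)
qed simp

lemma L_nilpotent: "\<exists>N. (L ^^ N) f = 0"
proof -
  obtain F N where F: "\<And>n. F n \<in> homogeneous n" and f: "f = (\<Sum>n<N. F n)"
    using homogeneous_decomp by blast
  have "(L ^^ N) f = 0"
    by (simp add: f linop_sum[OF linop_funpow[OF linop_L]] L_funpow_homogeneous[OF F])
  then show ?thesis ..
qed

lemma L_funpow_ge:
  assumes "(L ^^ N) f = 0" and "N \<le> n" shows "(L ^^ n) f = 0"
  using assms(2) by (induction n rule: dec_induct) (simp_all add: assms(1) linop_zero[OF linop_L])

lemma exp_half_laplace_eq:
  assumes "(L ^^ N) f = 0"
  shows "exp_half_laplace m l \<kappa> f = (\<Sum>n<N. vscale (1 / (2 ^ n * fact n)) ((L ^^ n) f))"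
  unfolding exp_half_laplace_def
proof (rule Sum_any.expand_superset)
  have "n < N" if "vscale (1 / (2 ^ n * fact n)) ((L ^^ n) f) \<noteq> 0" for n
  proof (rule ccontr)
    assume "\<not> n < N"
    then have "(L ^^ n) f = 0" using L_funpow_ge[OF assms] by simp
    with that show False by simp
  qed
  then show "{n. vscale (1 / (2 ^ n * fact n)) ((L ^^ n) f) \<noteq> 0} \<subseteq> {..<N}"
    by blast
qed (rule finite_lessThan)

lemma exp_half_laplace_harmonic:
  assumes "f \<in> harmonics m l \<kappa>" shows "exp_half_laplace m l \<kappa> f = f"
proof -
  \<comment> \<open>With N = 1 the exponential series is cut down to its term f.\<close>
  have "(L ^^ 1) f = 0" using assms by (simp add: harmonics_def dunkl_laplace_def)
  from exp_half_laplace_eq[OF this] show ?thesis by simp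
qed

lemma exp_half_laplace_nonzero:
  assumes "f \<noteq> 0" shows "exp_half_laplace m l \<kappa> f \<noteq> 0"
proof
  assume 0: "exp_half_laplace m l \<kappa> f = 0"
  \<comment> \<open>\<open>L ^^ (N - 1)\<close> kills every term of the exponential series except the first.\<close>
  define N where "N = (LEAST N. (L ^^ N) f = 0)"
  have N: "(L ^^ N) f = 0"
    unfolding N_def by (rule LeastI_ex[OF L_nilpotent])
  have least: "(L ^^ n) f \<noteq> 0" if "n < N" for n
    using that unfolding N_def by (rule not_less_Least)
  obtain i where i: "N = Suc i" using N assms by (metis funpow_0 not0_implies_Suc)
  have "(L ^^ i) ((L ^^ Suc n) f) = 0" for n
  proof -
    have "(L ^^ (i + Suc n)) f = 0" by (rule L_funpow_ge[OF N]) (simp add: i)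
    then show ?thesis by (simp only: funpow_add comp_apply)
  qed
  then have "(L ^^ i) (exp_half_laplace m l \<kappa> f) = (L ^^ i) f"
    unfolding exp_half_laplace_eq[OF N] i sum.lessThan_Suc_shift linop_rules[OF linop_funpow[OF linop_L]]
    by (simp del: funpow.simps add: funpow_0)
  then show False
    using least[of i] by (simp add: 0 i linop_zero[OF linop_funpow[OF linop_L]])
qed

lemma pos_def_gauss_harmonics:
  "pos_def_on (harmonics m l \<kappa>) (gauss_form m l \<kappa>) \<longleftrightarrow> pos_def_on (harmonics m l \<kappa>) B"
  by (simp add: pos_def_on_def gauss_form_def exp_half_laplace_harmonic)

lemma pos_def_gauss:
  "pos_def_on UNIV B \<Longrightarrow> pos_def_on UNIV (gauss_form m l \<kappa>)"
  unfolding pos_def_on_def gauss_form_def using exp_half_laplace_nonzero by blast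

end

theorem mainTheorem2:
  fixes m l :: nat and \<kappa> :: real
  assumes "m \<ge> 3" and "1 \<le> l" and "l \<le> (m - 1) div 2"
  shows "(pos_def_on (harmonics m l \<kappa>) (cform m l \<kappa>)
            \<longleftrightarrow> - (real l / real m) < \<kappa> \<and> \<kappa> < real l / real m)
       \<and> (pos_def_on (harmonics m l \<kappa>) (gauss_form m l \<kappa>)
            \<longleftrightarrow> - (real l / real m) < \<kappa> \<and> \<kappa> < real l / real m)
       \<and> (- (real l / real m) < \<kappa> \<and> \<kappa> < real l / real m
            \<longrightarrow> pos_def_on UNIV (cform m l \<kappa>) \<and> pos_def_on UNIV (gauss_form m l \<kappa>))"
proof -
  interpret vector_dunkl m l \<kappa>
    using assms by unfold_locales auto
  have range: "\<bar>\<kappa>\<bar> * m < l \<longleftrightarrow> - (real l / real m) < \<kappa> \<and> \<kappa> < real l / real m"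
    using assms(1) by (subst pos_less_divide_eq[symmetric]) (auto simp: abs_less_iff)
  \<comment> \<open>Sufficiency on the harmonics is a restriction from the whole space; necessity
    comes from the two witnesses.\<close>
  have "pos_def_on UNIV B \<Longrightarrow> pos_def_on (harmonics m l \<kappa>) B"
    unfolding pos_def_on_def by blast
  then show ?thesis
    using B_positive range_if_positive pos_def_gauss pos_def_gauss_harmonics range by blast
qed

end
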